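(* For every $k\in\mathbb{N}$ and all sufficiently large $n$, there exists a $2k$-additive spanner of the hypercube $Q_n$ with maximum degree at most \[10^{4k}\,\frac{n\,\ln^{(k+1)} n}{\ln n}.\]
   Context: $Q_n$ denotes the $n$-dimensional hypercube graph: its vertex set is $\{0,1\}^n$, and two vertices are adjacent if and only if they differ in exactly one coordinate. A subgraph $G\subseteq Q_n$ on the vertex set $\{0,1\}^n$ is a $k$-additive spanner if $\operatorname{dist}_G(x,y)\le \operatorname{dist}_{Q_n}(x,y)+k$ for all $x,y\in\{0,1\}^n$. The iterated logarithm is defined by $\ln^{(1)} n=\ln n$ and $\ln^{(j+1)} n=\ln(\ln^{(j)} n)$. *)

theory Defs
  imports Complex_Main "HOL-Library.FuncSet" "HOL-Library.Extended_Nat"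
begin

text \<open>A simple graph is a pair of a vertex set and a set of two-element vertex sets. The type does
  not enforce this, but it holds for the hypercube and for every spanner of it.\<close>

type_synonym 'a graph = "'a set \<times> 'a set set"

abbreviation verts :: "'a graph \<Rightarrow> 'a set" where "verts \<equiv> fst"

abbreviation edges :: "'a graph \<Rightarrow> 'a set set" where "edges \<equiv> snd"

definition walk :: "'a graph \<Rightarrow> 'a \<Rightarrow> 'a list \<Rightarrow> 'a \<Rightarrow> bool" where
  "walk G x p y \<longleftrightarrow>
     p \<noteq> [] \<and> hd p = x \<and> last p = y \<and> set p \<subseteq> verts G \<and>
     successively (\<lambda>u v. {u, v} \<in> edges G) p"

text \<open>The distance is \<open>\<infinity>\<close> when no walk joins the two vertices. A walk is given by its list of
  vertices, hence its length is one less than the length of the list.\<close>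

definition graph_dist :: "'a graph \<Rightarrow> 'a \<Rightarrow> 'a \<Rightarrow> enat" where
  "graph_dist G x y = (INF p \<in> {p. walk G x p y}. enat (length p - 1))"

definition degree :: "'a graph \<Rightarrow> 'a \<Rightarrow> nat" where
  "degree G v = card {e \<in> edges G. v \<in> e}"

definition max_degree :: "'a graph \<Rightarrow> nat" where
  "max_degree G = Max (degree G ` verts G)"

definition additive_spanner :: "nat \<Rightarrow> 'a graph \<Rightarrow> 'a graph \<Rightarrow> bool" where
  "additive_spanner k Q G \<longleftrightarrow>
     verts G = verts Q \<and> edges G \<subseteq> edges Q \<and>
     (\<forall>x \<in> verts Q. \<forall>y \<in> verts Q. graph_dist G x y \<le> graph_dist Q x y + enat k)"

text \<open>Elements of \<open>{0,1}\<^sup>n\<close> are Boolean functions on \<open>{..<n}\<close>, extended by \<open>undefined\<close> outside it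
  so that each vertex has exactly one representation.\<close>

definition cube :: "nat \<Rightarrow> (nat \<Rightarrow> bool) set" where
  "cube n = {..<n} \<rightarrow>\<^sub>E UNIV"

definition hypercube :: "nat \<Rightarrow> (nat \<Rightarrow> bool) graph" where
  "hypercube n =
     (cube n,
      {{x, y} | x y. x \<in> cube n \<and> y \<in> cube n \<and> card {i \<in> {..<n}. x i \<noteq> y i} = 1})"

text \<open>The iterated logarithm, with \<open>iter_ln 1 = ln\<close>. The values are the intended ones only where
  all intermediate iterates are positive, which holds for all large arguments.\<close>

definition iter_ln :: "nat \<Rightarrow> real \<Rightarrow> real" where
  "iter_ln j x = (ln ^^ j) x"

end

theory Submission
  imports Defs
begin

text \<open>A few coordinates are reserved for control, the rest form a set \<open>U\<^sub>0\<close>. The control part of a vertex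
  determines a chain \<open>U\<^sub>0 \<supseteq> U\<^sub>1 \<supseteq> \<dots> \<supseteq> U\<^sub>k\<close>, and \<open>k\<close> control flips can produce any chain of the
  family in use; making them and undoing them costs the \<open>2k\<close> additional steps. At a vertex \<open>b\<close> the
  directions in \<open>U\<^sub>k\<close> are always available, while \<open>U\<^sub>i\<^sub>-\<^sub>1 - U\<^sub>i\<close> is split into \<open>s\<^sub>i\<close> classes, of which only the
  one with index \<open>|b \<inter> U\<^sub>i| mod s\<^sub>i\<close> is available. To flip a set \<open>S\<close> upwards, choose the chain such that
  each \<open>U\<^sub>i\<close> contains \<open>S \<inter> U\<^sub>i\<^sub>-\<^sub>1\<close> or at least \<open>s\<^sub>i\<close> elements of it: while the elements of \<open>S \<inter> U\<^sub>i\<close> are flipped, the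
  counter runs through all residues, and every class of \<open>U\<^sub>i\<^sub>-\<^sub>1 - U\<^sub>i\<close> gets its turn. Downward flips are
  the reversal of upward flips. A set of density \<open>1/r\<^sub>i\<close> in \<open>U\<^sub>i\<^sub>-\<^sub>1\<close> containing \<open>2 s\<^sub>i\<close> prescribed elements
  can be found among \<open>(3 r\<^sub>i)\<close> to the power \<open>2 s\<^sub>i\<close> candidates. With \<open>L\<^sub>j\<close> the \<open>j\<close>-th iterated logarithm of \<open>n\<close>,
  the choice \<open>s\<^sub>i \<approx> L\<^sub>1 / (8 L\<^sub>j\<^sub>+\<^sub>1)\<close> and \<open>r\<^sub>i \<approx> L\<^sub>j / L\<^sub>j\<^sub>+\<^sub>1\<close>, where \<open>j = k + 1 - i\<close>, bounds this number by
  \<open>\<surd>n\<close> and makes the available part of every level have size \<open>O(n L\<^sub>k\<^sub>+\<^sub>1 / L\<^sub>1)\<close>.\<close>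

section \<open>Balanced partitions and covering families\<close>

text \<open>Number the elements of \<open>U\<close> and label them by residues mod \<open>Q\<close>;
  within one class the quotient by \<open>Q\<close> tells elements apart.\<close>

lemma balanced_labelling:
  fixes U :: "'a set" and Q :: nat
  assumes "finite U" "Q > 0"
  obtains f :: "'a \<Rightarrow> nat" where "\<And>u. f u < Q"
    "\<And>l. card {u \<in> U. f u = l} \<le> card U div Q + 1"
proof -
  obtain h where h: "bij_betw h U {0..<card U}"
    using ex_bij_betw_finite_nat[OF assms(1)] by blast
  have "card {u \<in> U. h u mod Q = l} \<le> card U div Q + 1" for l
  proof -
    let ?g = "\<lambda>u. h u div Q"
    have "inj_on ?g {u \<in> U. h u mod Q = l}"
    proof (rule inj_onI)
      fix u v
      assume "u \<in> {u \<in> U. h u mod Q = l}" "v \<in> {u \<in> U. h u mod Q = l}" "h u div Q = h v div Q"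
      then have "h u = h v" "u \<in> U" "v \<in> U"
        by (auto, metis div_mult_mod_eq)
      then show "u = v" using h by (meson bij_betw_imp_inj_on inj_on_def)
    qed
    moreover have "?g ` {u \<in> U. h u mod Q = l} \<subseteq> {..card U div Q}"
    proof -
      have "h u < card U" if "u \<in> U" for u
        using bij_betwE[OF h] that by fastforce
      then show ?thesis by (auto intro: div_le_mono dest: less_imp_le)
    qed
    ultimately have "card {u \<in> U. h u mod Q = l} \<le> card {..card U div Q}"
      by (rule card_inj_on_le) simp
    then show ?thesis by simp
  qed
  then show thesis using that[of "\<lambda>u. h u mod Q"] assms(2) by simp
qed

text \<open>A single term of the expansion of \<open>(x + 1) ^ N\<close> at \<open>x = 1 / r\<close>
  is at most the whole sum, which is at most \<open>exp x ^ N = exp 1 ^ m\<close>.\<close>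

lemma binomial_mult_le:
  assumes "r > 0"
  shows "m * r choose m \<le> (3 * r) ^ m"
proof -
  define N x where "N = m * r" and "x = 1 / real r"
  have x: "x > 0" using assms by (simp add: x_def)
  have "real (N choose m) * x ^ m \<le> (\<Sum>k\<le>N. real (N choose k) * x ^ k)"
    using assms x by (intro member_le_sum) (auto simp: N_def)
  also have "\<dots> = (x + 1) ^ N"
    using binomial_ring[of x 1 N] by simp
  also have "\<dots> \<le> exp x ^ N"
    using x by (intro power_mono) (auto simp: add.commute)
  also have "\<dots> = exp 1 ^ m"
    using assms by (simp add: x_def N_def flip: exp_of_nat_mult)
  also have "\<dots> \<le> 3 ^ m"
    using exp_le by (intro power_mono) auto
  finally have "real (N choose m) \<le> 3 ^ m * real r ^ m"
    using assms by (simp add: x_def field_simps)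
  then have "real (N choose m) \<le> real ((3 * r) ^ m)"
    by (simp add: power_mult_distrib)
  then show ?thesis unfolding N_def of_nat_le_iff .
qed

text \<open>\<open>U\<close> is cut into \<open>Q = 2 * s * r\<close> balanced blocks and the
  members of \<open>F\<close> are the unions of \<open>2 * s\<close> blocks: \<open>s\<close>
  elements of \<open>S\<close> and \<open>s\<close> of \<open>S'\<close> meet at most
  \<open>2 * s\<close> blocks. The summand \<open>2 * s\<close> in the size bound comes from
  rounding the block sizes.\<close>

lemma covering_family:
  fixes U :: "'a set"
  assumes "finite U" "s > 0" "r > 0"
  obtains F where "finite F" "F \<noteq> {}" "card F \<le> (3 * r) ^ (2 * s)"
    "\<And>W. W \<in> F \<Longrightarrow> W \<subseteq> U \<and> real (card W) \<le> real (card U) / real r + 2 * real s"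
    "\<And>S S'. S \<subseteq> U \<Longrightarrow> S' \<subseteq> U \<Longrightarrow>
      \<exists>W\<in>F. (S \<subseteq> W \<or> s \<le> card (S \<inter> W)) \<and> (S' \<subseteq> W \<or> s \<le> card (S' \<inter> W))"
proof -
  define Q where "Q = 2 * s * r"
  have Q: "Q > 0" "2 * s \<le> Q" using assms by (auto simp: Q_def)
  obtain f :: "'a \<Rightarrow> nat" where f: "\<And>u. f u < Q"
    "\<And>l. card {u \<in> U. f u = l} \<le> card U div Q + 1"
    using balanced_labelling[OF assms(1) Q(1)] by blast
  define T where "T = {X. X \<subseteq> {..<Q} \<and> card X = 2 * s}"
  define W where "W X = {u \<in> U. f u \<in> X}" for X
  have cT: "card T = Q choose (2 * s)"
    unfolding T_def using n_subsets[of "{..<Q}" "2 * s"] by simp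
  have finT: "finite T" unfolding T_def by simp
  show thesis
  proof (rule that[of "W ` T"])
    show "finite (W ` T)" using finT by simp
    have "card T > 0" unfolding cT using Q by simp
    then show "W ` T \<noteq> {}" by auto
    show "card (W ` T) \<le> (3 * r) ^ (2 * s)"
      using card_image_le[OF finT, of W] binomial_mult_le[OF assms(3), of "2 * s"]
      by (simp add: cT Q_def)
  next
    fix Y assume "Y \<in> W ` T"
    then obtain X where X: "X \<subseteq> {..<Q}" "card X = 2 * s" "Y = W X" by (auto simp: T_def)
    have "Y = (\<Union>l\<in>X. {u \<in> U. f u = l})" by (auto simp: X W_def)
    then have "card Y \<le> (\<Sum>l\<in>X. card {u \<in> U. f u = l})"
      using X(1) finite_subset by (auto intro!: card_UN_le)
    also have "\<dots> \<le> (\<Sum>l\<in>X. card U div Q + 1)"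
      by (intro sum_mono f)
    also have "\<dots> = 2 * s * (card U div Q + 1)" using X by simp
    finally have "real (card Y) \<le> real (2 * s * (card U div Q + 1))" by linarith
    also have "\<dots> = 2 * real s * (real (card U div Q) + 1)" by (simp add: algebra_simps)
    also have "\<dots> \<le> 2 * real s * (real (card U) / real Q + 1)"
      using of_nat_div_le_of_nat[of "card U" Q, where 'a = real] by (intro mult_left_mono add_mono) simp_all
    also have "\<dots> = real (card U) / real r + 2 * real s"
      using assms by (simp add: Q_def field_simps)
    finally show "Y \<subseteq> U \<and> real (card Y) \<le> real (card U) / real r + 2 * real s"
      by (auto simp: X W_def)
  next
    fix S S' assume S: "S \<subseteq> U" "S' \<subseteq> U"
    \<comment> \<open>It is enough to capture a small part of \<open>S\<close>: all of it, or
      exactly \<open>s\<close> elements.\<close>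
    have pick: "\<exists>Z\<subseteq>S. card Z \<le> s \<and> (Z = S \<or> card Z = s)" if "S \<subseteq> U" for S
    proof (cases "card S \<le> s")
      case False
      then show ?thesis using obtain_subset_with_card_n[of s S] by (metis nat_le_linear)
    qed auto
    obtain Z where Z: "Z \<subseteq> S" "card Z \<le> s" "Z = S \<or> card Z = s" using pick[OF S(1)] by blast
    obtain Z' where Z': "Z' \<subseteq> S'" "card Z' \<le> s" "Z' = S' \<or> card Z' = s"
      using pick[OF S(2)] by blast
    have fin: "finite S" "finite S'" using S assms(1) finite_subset by auto
    then have "finite (Z \<union> Z')" using Z(1) Z'(1) finite_subset by auto
    then have "card (f ` (Z \<union> Z')) \<le> 2 * s"
      using card_image_le[of "Z \<union> Z'" f] card_Un_le[of Z Z'] Z(2) Z'(2) by linarith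
    \<comment> \<open>The blocks that are met are padded to exactly \<open>2 * s\<close>.\<close>
    then obtain X where X: "f ` (Z \<union> Z') \<subseteq> X" "X \<subseteq> {..<Q}" "card X = 2 * s"
      using exists_subset_between[of "f ` (Z \<union> Z')" "2 * s" "{..<Q}"] f(1) Q(2) by auto
    have sub: "Z \<subseteq> W X" "Z' \<subseteq> W X" using X Z Z' S by (auto simp: W_def)
    have "S \<subseteq> W X \<or> s \<le> card (S \<inter> W X)"
      using sub Z fin card_mono[of "S \<inter> W X" Z] by auto
    moreover have "S' \<subseteq> W X \<or> s \<le> card (S' \<inter> W X)"
      using sub Z' fin card_mono[of "S' \<inter> W X" Z'] by auto
    moreover have "X \<in> T" using X by (simp add: T_def)
    ultimately show "\<exists>W\<in>W ` T. (S \<subseteq> W \<or> s \<le> card (S \<inter> W)) \<and> (S' \<subseteq> W \<or> s \<le> card (S' \<inter> W))"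
      by blast
  qed
qed

section \<open>Monotone paths and routers\<close>

text \<open>A vertex is the set of its coordinates equal to 1. Only upward flips are recorded; a
  descent is a climb read backwards.\<close>

definition climb :: "('a set \<Rightarrow> 'a set) \<Rightarrow> 'a set \<Rightarrow> 'a set \<Rightarrow> bool" where
  "climb av = (\<lambda>b c. \<exists>i. i \<notin> b \<and> i \<in> av b \<and> c = insert i b)\<^sup>*\<^sup>*"

lemma climb_refl: "climb av b b"
  by (simp add: climb_def)

lemma climb_insert: "i \<notin> b \<Longrightarrow> i \<in> av b \<Longrightarrow> climb av (insert i b) c \<Longrightarrow> climb av b c"
  unfolding climb_def by (rule converse_rtranclp_into_rtranclp) auto

lemma climb_induct [consumes 1, case_names refl insert]:
  assumes "climb av b c" "\<And>b. P b b"
    "\<And>i b c. i \<notin> b \<Longrightarrow> i \<in> av b \<Longrightarrow> climb av (insert i b) c \<Longrightarrow> P (insert i b) c \<Longrightarrow> P b c"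
  shows "P b c"
  using assms(1) unfolding climb_def
  by (induction rule: converse_rtranclp_induct) (use assms(2,3) in \<open>auto simp: climb_def\<close>)

lemma climb_trans: "climb av a b \<Longrightarrow> climb av b c \<Longrightarrow> climb av a c"
  unfolding climb_def by (rule rtranclp_trans)

lemma climb_subset: "climb av b c \<Longrightarrow> b \<subseteq> c"
  by (induction rule: climb_induct) auto

lemma climb_free:
  assumes "finite R" "R \<inter> b = {}" "\<And>c. b \<subseteq> c \<Longrightarrow> c \<subseteq> b \<union> R \<Longrightarrow> R \<subseteq> av c"
  shows "climb av b (b \<union> R)"
  using assms
proof (induction R arbitrary: b rule: finite_induct)
  case empty
  then show ?case by (simp add: climb_refl)
next
  case (insert x R)
  have "climb av (insert x b) (insert x b \<union> R)"
    using insert.prems insert.hyps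
  proof (intro insert.IH)
    fix c assume "insert x b \<subseteq> c" "c \<subseteq> insert x b \<union> R"
    then show "R \<subseteq> av c" using insert.prems(2)[of c] by auto
  qed auto
  moreover have "x \<in> av b" using insert.prems(2)[of b] by auto
  ultimately show ?case using insert.prems(1) by (auto intro: climb_insert)
qed

text \<open>The given climb inside \<open>W\<close> is followed, and before each of its flips every
  direction of \<open>R\<close> labelled by the current counter value is flipped. \<open>r0\<close>
  holds the coordinates outside \<open>W\<close> that are already set.\<close>

lemma climb_interleave:
  assumes "climb av' p q" "finite p" "p \<subseteq> W" "r0 \<inter> W = {}" "finite R" "R \<inter> W = {}" "R \<inter> r0 = {}" "q \<subseteq> W"
    and av': "\<And>b. av' (b \<inter> W) \<inter> W \<subseteq> av b"
    and av: "\<And>b i. i \<in> R \<Longrightarrow> f i = card (b \<inter> W) mod s \<Longrightarrow> i \<in> av b"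
    and R: "\<And>i. i \<in> R \<Longrightarrow> \<exists>m. card p \<le> m \<and> m \<le> card q \<and> f i = m mod s"
  shows "climb av (p \<union> r0) (q \<union> r0 \<union> R)"
  using assms(1-8) av R
proof (induction arbitrary: r0 R rule: climb_induct)
  \<comment> \<open>The inner climb is over, so \<open>m\<close> can only be \<open>card p\<close>
    and all of \<open>R\<close> is available.\<close>
  case (refl p)
  have "climb av (p \<union> r0) (p \<union> r0 \<union> R)"
  proof (rule climb_free)
    fix c assume c: "p \<union> r0 \<subseteq> c" "c \<subseteq> p \<union> r0 \<union> R"
    then have "c \<inter> W = p" using refl.prems by blast
    then show "R \<subseteq> av c" using refl.prems(8,9) by (metis le_antisym subsetI)
  qed (use refl.prems in auto)
  then show ?case .
next
  case (insert i p q)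
  \<comment> \<open>The part of \<open>R\<close> open at the present counter value; it lies outside
    \<open>W\<close>, so flipping it does not move the counter.\<close>
  define R1 where "R1 = {i\<in>R. f i = card p mod s}"
  have 1: "climb av (p \<union> r0) (p \<union> r0 \<union> R1)"
  proof (rule climb_free)
    fix c assume c: "p \<union> r0 \<subseteq> c" "c \<subseteq> p \<union> r0 \<union> R1"
    then have "c \<inter> W = p" using insert.prems by (auto simp: R1_def)
    then show "R1 \<subseteq> av c" using insert.prems(8) by (auto simp: R1_def)
  qed (use insert.prems in \<open>auto simp: R1_def\<close>)
  have iW: "insert i p \<subseteq> W" using climb_subset[OF insert.hyps(3)] insert.prems(7) by blast
  have 2: "climb av (insert i p \<union> (r0 \<union> R1)) (q \<union> (r0 \<union> R1) \<union> (R - R1))"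
  proof (rule insert.IH)
    show "\<exists>m. card (insert i p) \<le> m \<and> m \<le> card q \<and> f j = m mod s" if "j \<in> R - R1" for j
    proof -
      obtain m where m: "card p \<le> m" "m \<le> card q" "f j = m mod s"
        using insert.prems(9) \<open>j \<in> R - R1\<close> by blast
      \<comment> \<open>A direction left over after \<open>R1\<close> must wait for a larger counter
        value.\<close>
      then have "m \<noteq> card p" using that by (auto simp: R1_def)
      then show ?thesis using m insert.hyps(1) insert.prems(1) by (intro exI[of _ m]) auto
    qed
  qed (use iW insert.prems in \<open>auto simp: R1_def\<close>)
  have "(p \<union> r0 \<union> R1) \<inter> W = p" using insert.prems by (auto simp: R1_def)
  then have 3: "i \<in> av (p \<union> r0 \<union> R1)" using av'[of "p \<union> r0 \<union> R1"] iW insert.hyps(2) by auto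
  have "i \<notin> p \<union> r0 \<union> R1" using insert.hyps(1) iW insert.prems by (auto simp: R1_def)
  moreover have "insert i p \<union> (r0 \<union> R1) = insert i (p \<union> r0 \<union> R1)" by auto
  ultimately have "climb av (p \<union> r0 \<union> R1) (q \<union> (r0 \<union> R1) \<union> (R - R1))"
    using 2 3 climb_insert[of i "p \<union> r0 \<union> R1" av] by simp
  moreover have "q \<union> (r0 \<union> R1) \<union> (R - R1) = q \<union> r0 \<union> R" by (auto simp: R1_def)
  ultimately show ?case using 1 climb_trans by metis
qed

text \<open>Makes availability a property of the edge rather than of one endpoint, so that the size
  of \<open>av b\<close> bounds the degree.\<close>

definition flip_stable :: "('a set \<Rightarrow> 'a set) \<Rightarrow> bool" where
  "flip_stable av \<longleftrightarrow> (\<forall>b i. i \<in> av (insert i b) \<longleftrightarrow> i \<in> av (b - {i}))"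

text \<open>All starting vertices are covered at once, since the climbs for the upward and the
  downward flips of one path start at different vertices.\<close>

definition routes :: "('a set \<Rightarrow> 'a set) \<Rightarrow> 'a set \<Rightarrow> 'a set \<Rightarrow> bool" where
  "routes av U S \<longleftrightarrow> (\<forall>b\<subseteq>U. b \<inter> S = {} \<longrightarrow> climb av b (b \<union> S))"

text \<open>The upward flips \<open>S\<close> and the downward flips \<open>S'\<close> of a path must be served by the same \<open>js\<close>, since
  changing \<open>js\<close> in the middle of the path would need further control flips.\<close>

definition router :: "nat \<Rightarrow> 'c set \<Rightarrow> 'a set \<Rightarrow> real \<Rightarrow> ('c list \<Rightarrow> 'a set \<Rightarrow> 'a set) \<Rightarrow> bool" where
  "router m I U d av \<longleftrightarrow>
    (\<forall>js. set js \<subseteq> I \<longrightarrow> length js = m \<longrightarrow> flip_stable (av js) \<and> (\<forall>b. av js b \<subseteq> U \<and> real (card (av js b)) \<le> d)) \<and>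
    (\<forall>S S'. S \<subseteq> U \<longrightarrow> S' \<subseteq> U \<longrightarrow>
      (\<exists>js. set js \<subseteq> I \<and> length js = m \<and> routes (av js) U S \<and> routes (av js) U S'))"

lemma router_0:
  assumes "finite U"
  shows "router 0 I U (real (card U)) (\<lambda>_ _. U)"
  unfolding router_def flip_stable_def routes_def
  using assms by (auto intro!: climb_free intro: finite_subset)

text \<open>If \<open>S\<close> leaves \<open>W\<close>, the climb inside \<open>W\<close> has at
  least \<open>s\<close> steps, so the counter meets every residue and each class outside
  \<open>W\<close> is open at some time.\<close>

lemma routes_extend:
  assumes "finite U" "W \<subseteq> U" "s > 0" "S \<subseteq> U"
    and inner: "routes av' W (S \<inter> W)"
    and big: "S \<subseteq> W \<or> s \<le> card (S \<inter> W)"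
    and f: "\<And>u. f u < s"
  shows "routes (\<lambda>b. av' (b \<inter> W) \<union> {u \<in> U - W. f u = card (b \<inter> W) mod s}) U S"
  unfolding routes_def
proof (intro allI impI)
  fix b assume b: "b \<subseteq> U" "b \<inter> S = {}"
  let ?av = "\<lambda>b. av' (b \<inter> W) \<union> {u \<in> U - W. f u = card (b \<inter> W) mod s}"
  have fin: "finite b" "finite S" using b assms finite_subset by auto
  have "climb av' (b \<inter> W) (b \<inter> W \<union> S \<inter> W)"
    using inner b unfolding routes_def by auto
  then have "climb ?av (b \<inter> W \<union> (b - W)) (b \<inter> W \<union> S \<inter> W \<union> (b - W) \<union> (S - W))"
  proof (rule climb_interleave[where W = W and f = f and s = s])
    fix i assume i: "i \<in> S - W"
    then have "s \<le> card (S \<inter> W)" using big by auto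
    then have le: "card (b \<inter> W) + s \<le> card (b \<inter> W) + card (S \<inter> W)" by simp
    have card_Un: "card (b \<inter> W \<union> S \<inter> W) = card (b \<inter> W) + card (S \<inter> W)"
      using b fin by (intro card_Un_disjoint) auto
    define c where "c = card (b \<inter> W)"
    \<comment> \<open>The least number from \<open>c\<close> on that is congruent to
      \<open>f i\<close>; the summand \<open>s\<close> keeps the natural subtraction from
      truncating.\<close>
    define m where "m = c + (f i + s - c mod s) mod s"
    have "m mod s = (c mod s + (f i + s - c mod s)) mod s"
      unfolding m_def by (simp add: mod_add_right_eq mod_add_left_eq)
    also have "\<dots> = (s + f i) mod s"
      using mod_less_divisor[OF assms(3), of c] by (intro arg_cong[where f = "\<lambda>x. x mod s"]) linarith
    also have "\<dots> = f i mod s" by simp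
    finally have "f i = m mod s" using f by simp
    moreover have "c \<le> m" "m \<le> c + s" using assms(3) by (auto simp: m_def less_imp_le)
    ultimately show "\<exists>m. card (b \<inter> W) \<le> m \<and> m \<le> card (b \<inter> W \<union> S \<inter> W) \<and> f i = m mod s"
      using le card_Un unfolding c_def by (intro exI[of _ m]) auto
  qed (use b fin assms(4) in auto)
  moreover have "b \<inter> W \<union> (b - W) = b" "b \<inter> W \<union> S \<inter> W \<union> (b - W) \<union> (S - W) = b \<union> S" by auto
  ultimately show "climb ?av b (b \<union> S)" by simp
qed

text \<open>The head of \<open>js\<close> selects a member \<open>W\<close> of a covering family,
  the tail drives the inner router on \<open>W\<close>. The added degree is one of \<open>s\<close>
  balanced classes of directions.\<close>

lemma router_Suc:
  fixes U :: "'a set" and I :: "'c set"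
  assumes "finite U" "s > 0" "r > 0" "finite I" "(3 * r) ^ (2 * s) \<le> card I"
    and inner: "\<And>W. W \<subseteq> U \<Longrightarrow> real (card W) \<le> real (card U) / real r + 2 * real s \<Longrightarrow> \<exists>av. router m I W d av"
  shows "\<exists>av. router (Suc m) I U (d + real (card U) / real s + 1) av"
proof -
  obtain F where F: "finite F" "F \<noteq> {}" "card F \<le> (3 * r) ^ (2 * s)"
    "\<And>W. W \<in> F \<Longrightarrow> W \<subseteq> U \<and> real (card W) \<le> real (card U) / real r + 2 * real s"
    "\<And>S S'. S \<subseteq> U \<Longrightarrow> S' \<subseteq> U \<Longrightarrow>
      \<exists>W\<in>F. (S \<subseteq> W \<or> s \<le> card (S \<inter> W)) \<and> (S' \<subseteq> W \<or> s \<le> card (S' \<inter> W))"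
    using covering_family[OF assms(1-3)] by blast
  obtain h where h: "h ` F \<subseteq> I" "inj_on h F"
    using card_le_inj[OF F(1) assms(4)] F(3) assms(5) by auto
  \<comment> \<open>Symbols outside the image of \<open>h\<close> select an arbitrary member, so
    that every list over \<open>I\<close> is meaningful.\<close>
  define g where "g j = (if j \<in> h ` F then the_inv_into F h j else (SOME W. W \<in> F))" for j
  have g: "g ` I = F"
  proof
    have gh: "g (h W) = W" if "W \<in> F" for W
      using that h(2) by (simp add: g_def the_inv_into_f_f)
    have "(SOME W. W \<in> F) \<in> F" using F(2) by (simp add: some_in_eq)
    then have "g j \<in> F" for j
      using gh by (cases "j \<in> h ` F") (auto simp: g_def)
    then show "g ` I \<subseteq> F" by blast
    show "F \<subseteq> g ` I"
    proof
      fix W assume "W \<in> F"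
      then show "W \<in> g ` I" using gh[of W] h(1) by (intro image_eqI[of _ _ "h W"]) auto
    qed
  qed
  obtain A where A: "\<And>W. W \<in> F \<Longrightarrow> router m I W d (A W)"
    using F(4) inner by metis
  obtain f :: "'a \<Rightarrow> nat" where f: "\<And>u. f u < s"
    "\<And>l. card {u \<in> U. f u = l} \<le> card U div s + 1"
    using balanced_labelling[OF assms(1,2)] by blast
  define av where "av js = (\<lambda>b. A (g (hd js)) (tl js) (b \<inter> g (hd js)) \<union>
      {u \<in> U - g (hd js). f u = card (b \<inter> g (hd js)) mod s})" for js
  have "router (Suc m) I U (d + real (card U) / real s + 1) av"
    unfolding router_def
  proof (intro conjI allI impI)
    fix js :: "'c list" assume js: "set js \<subseteq> I" "length js = Suc m"
    define W where "W = g (hd js)"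
    have js': "hd js \<in> I" "set (tl js) \<subseteq> I" "length (tl js) = m"
      using js by (cases js; simp)+
    have WF: "W \<in> F" using js'(1) g unfolding W_def by blast
    have WU: "W \<subseteq> U" using F(4) WF by blast
    have rt: "flip_stable (A W (tl js))" "\<And>b. A W (tl js) b \<subseteq> W"
      "\<And>b. real (card (A W (tl js) b)) \<le> d"
      using A[OF WF] js'(2,3) unfolding router_def by auto
    show "flip_stable (av js)"
      unfolding flip_stable_def
    proof (intro allI)
      fix b i
      show "i \<in> av js (insert i b) \<longleftrightarrow> i \<in> av js (b - {i})"
      \<comment> \<open>Inside \<open>W\<close> stability is inherited from the inner router;
        outside, a flip leaves the counter, which sees only \<open>W\<close>, unchanged.\<close>
      proof (cases "i \<in> W")
        case True
        then have "insert i b \<inter> W = insert i (b \<inter> W)" "(b - {i}) \<inter> W = b \<inter> W - {i}" by auto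
        moreover have "i \<in> A W (tl js) (insert i (b \<inter> W)) \<longleftrightarrow> i \<in> A W (tl js) (b \<inter> W - {i})"
          using rt(1) unfolding flip_stable_def by blast
        ultimately show ?thesis using True unfolding av_def W_def[symmetric] by simp
      next
        case False
        then have "insert i b \<inter> W = b \<inter> W" "(b - {i}) \<inter> W = b \<inter> W" by auto
        then show ?thesis unfolding av_def W_def[symmetric] by simp
      qed
    qed
    fix b
    show "av js b \<subseteq> U" using rt(2)[of "b \<inter> W"] WU unfolding av_def W_def[symmetric] by auto
    have "card (av js b) \<le> card (A W (tl js) (b \<inter> W)) + card {u \<in> U - W. f u = card (b \<inter> W) mod s}"
      unfolding av_def W_def[symmetric] by (rule card_Un_le)
    also have "card {u \<in> U - W. f u = card (b \<inter> W) mod s} \<le> card {u \<in> U. f u = card (b \<inter> W) mod s}"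
      using assms(1) by (intro card_mono) auto
    also have "\<dots> \<le> card U div s + 1" by (rule f)
    finally have "real (card (av js b)) \<le> real (card (A W (tl js) (b \<inter> W))) + real (card U div s) + 1"
      by linarith
    then show "real (card (av js b)) \<le> d + real (card U) / real s + 1"
      using rt(3)[of "b \<inter> W"] of_nat_div_le_of_nat[of "card U" s, where 'a = real] by linarith
  next
    fix S S' assume S: "S \<subseteq> U" "S' \<subseteq> U"
    then obtain W where W: "W \<in> F" "S \<subseteq> W \<or> s \<le> card (S \<inter> W)" "S' \<subseteq> W \<or> s \<le> card (S' \<inter> W)"
      using F(5) by blast
    obtain j where j: "j \<in> I" "g j = W" using g W(1) by blast
    have WU: "W \<subseteq> U" using F(4) W(1) by blast
    obtain js where js: "set js \<subseteq> I" "length js = m" "routes (A W js) W (S \<inter> W)"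
      "routes (A W js) W (S' \<inter> W)"
      using A[OF W(1)] unfolding router_def by (meson Int_lower2)
    have "av (j # js) = (\<lambda>b. A W js (b \<inter> W) \<union> {u \<in> U - W. f u = card (b \<inter> W) mod s})"
      by (simp add: av_def j)
    then have "routes (av (j # js)) U S" "routes (av (j # js)) U S'"
      using routes_extend[OF assms(1) WU assms(2) S(1) js(3) W(2) f(1)]
        routes_extend[OF assms(1) WU assms(2) S(2) js(4) W(3) f(1)] by (simp_all only:)
    then show "\<exists>js. set js \<subseteq> I \<and> length js = Suc m \<and> routes (av js) U S \<and> routes (av js) U S'"
      using js j by (intro exI[of _ "j # js"]) auto
  qed
  then show ?thesis by blast
qed

section \<open>Control coordinates\<close>

lemma odd_card_sym_diff_singleton:
  assumes "finite M"
  shows "odd (card (sym_diff M {x})) \<longleftrightarrow> even (card M)"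
proof (cases "x \<in> M")
  case True
  then have "sym_diff M {x} = M - {x}" "card M = Suc (card (M - {x}))"
    using card.remove[OF assms True] by auto
  then show ?thesis by simp
next
  case False
  then have "sym_diff M {x} = insert x M" by auto
  then show ?thesis using assms False by simp
qed

text \<open>A Hamming-type colouring: the coordinates are the pairs \<open>(i, X)\<close>, and the \<open>i\<close>-th colour of \<open>a\<close> is
  the sum over \<open>\<int>/2\<close> of the sets \<open>X\<close> with \<open>(i, X) \<in> a\<close>, so one flip changes it to any other value.\<close>

lemma parity_colouring:
  fixes k t :: nat
  defines "A \<equiv> {..<k} \<times> Pow {..<t}"
  obtains c :: "(nat \<times> nat set) set \<Rightarrow> nat set list" where
    "\<And>a. set (c a) \<subseteq> Pow {..<t} \<and> length (c a) = k"
    "\<And>a js. a \<subseteq> A \<Longrightarrow> set js \<subseteq> Pow {..<t} \<Longrightarrow> length js = k \<Longrightarrow>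
      \<exists>D\<subseteq>A. card D \<le> k \<and> c (sym_diff a D) = js"
proof -
  define M where "M a i l = {X. (i, X) \<in> a \<and> l \<in> X}" for a :: "(nat \<times> nat set) set" and i l
  define c where "c a = map (\<lambda>i. {l \<in> {..<t}. odd (card (M a i l))}) [0..<k]" for a
  show thesis
  proof (rule that[of c])
    show "set (c a) \<subseteq> Pow {..<t} \<and> length (c a) = k" for a by (auto simp: c_def)
  next
    fix a and js :: "nat set list"
    assume a: "a \<subseteq> A" and js: "set js \<subseteq> Pow {..<t}" "length js = k"
    \<comment> \<open>Flipping the one coordinate \<open>(i, E i)\<close> adds \<open>E i\<close> to
      the \<open>i\<close>-th colour and turns it into \<open>js ! i\<close>.\<close>
    define E where "E i = sym_diff (c a ! i) (js ! i)" for i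
    define D where "D = (\<lambda>i. (i, E i)) ` {..<k}"
    have sub: "c a ! i \<subseteq> {..<t}" "js ! i \<subseteq> {..<t}" if "i < k" for i
    proof -
      show "c a ! i \<subseteq> {..<t}" using that by (auto simp: c_def)
      show "js ! i \<subseteq> {..<t}" using js that nth_mem[of i js] by blast
    qed
    have "D \<subseteq> A"
      using sub by (force simp: D_def A_def E_def)
    moreover have "card D \<le> k"
      using card_image_le[of "{..<k}" "\<lambda>i. (i, E i)"] by (simp add: D_def)
    moreover have "c (sym_diff a D) = js"
    proof (rule nth_equalityI)
      show "length (c (sym_diff a D)) = length js" using js by (simp add: c_def)
      fix i assume "i < length (c (sym_diff a D))"
      then have i: "i < k" by (simp add: c_def)
      have fin: "finite (M a i l)" for l
      proof (rule finite_subset)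
        show "M a i l \<subseteq> Pow {..<t}" using a by (auto simp: M_def A_def)
      qed simp
      have "odd (card (M (sym_diff a D) i l)) \<longleftrightarrow> l \<in> js ! i" if "l < t" for l
      proof (cases "l \<in> E i")
        case True
        have "M (sym_diff a D) i l = sym_diff (M a i l) {E i}"
          using True i by (auto simp: M_def D_def)
        then have "odd (card (M (sym_diff a D) i l)) \<longleftrightarrow> even (card (M a i l))"
          using odd_card_sym_diff_singleton[OF fin] by simp
        moreover have "l \<in> c a ! i \<longleftrightarrow> odd (card (M a i l))"
          using i that by (simp add: c_def)
        ultimately show ?thesis using True by (auto simp: E_def)
      next
        case False
        have "M (sym_diff a D) i l = M a i l"
          using False i by (auto simp: M_def D_def)
        moreover have "l \<in> c a ! i \<longleftrightarrow> odd (card (M a i l))"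
          using i that by (simp add: c_def)
        ultimately show ?thesis using False by (auto simp: E_def)
      qed
      then have "{l \<in> {..<t}. odd (card (M (sym_diff a D) i l))} = js ! i"
        using sub(2)[OF i] by auto
      then show "c (sym_diff a D) ! i = js ! i" using i by (simp add: c_def)
    qed
    ultimately show "\<exists>D\<subseteq>A. card D \<le> k \<and> c (sym_diff a D) = js" by blast
  qed
qed

text \<open>Transport of \<open>parity_colouring\<close> along a bijection.\<close>

lemma control_colouring:
  fixes A :: "'a set" and k t :: nat
  assumes "finite A" "card A = k * 2 ^ t"
  obtains c :: "'a set \<Rightarrow> nat set list" where
    "\<And>a. set (c a) \<subseteq> Pow {..<t} \<and> length (c a) = k"
    "\<And>a js. a \<subseteq> A \<Longrightarrow> set js \<subseteq> Pow {..<t} \<Longrightarrow> length js = k \<Longrightarrow>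
      \<exists>D\<subseteq>A. card D \<le> k \<and> c (sym_diff a D) = js"
proof -
  let ?A = "{..<k} \<times> Pow {..<t}"
  obtain c :: "(nat \<times> nat set) set \<Rightarrow> nat set list" where c:
    "\<And>a. set (c a) \<subseteq> Pow {..<t} \<and> length (c a) = k"
    "\<And>a js. a \<subseteq> ?A \<Longrightarrow> set js \<subseteq> Pow {..<t} \<Longrightarrow> length js = k \<Longrightarrow>
      \<exists>D\<subseteq>?A. card D \<le> k \<and> c (sym_diff a D) = js"
    using parity_colouring[of t k] by blast
  have "card A = card ?A" using assms by (simp add: card_cartesian_product card_Pow)
  then obtain h where h: "bij_betw h A ?A"
    using assms(1) by (metis bij_betw_iff_card finite_Pow_iff finite_SigmaI finite_lessThan)
  show thesis
  proof (rule that[of "\<lambda>a. c (h ` a)"])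
    fix a js assume a: "a \<subseteq> A" and js: "set js \<subseteq> Pow {..<t}" "length js = k"
    have "h ` a \<subseteq> ?A" using h a by (auto simp: bij_betw_def)
    then obtain D where D: "D \<subseteq> ?A" "card D \<le> k" "c (sym_diff (h ` a) D) = js"
      using c(2)[OF _ js] by blast
    obtain D' where D': "D' \<subseteq> A" "D = h ` D'"
      using D(1) h unfolding bij_betw_def by (metis subset_imageE)
    have inj: "inj_on h A" using h by (simp add: bij_betw_def)
    then have "card D' = card D" using D' by (metis card_image inj_on_subset)
    moreover have "h ` sym_diff a D' = sym_diff (h ` a) D"
    proof -
      have "a - D' \<subseteq> A" "D' - a \<subseteq> A" using a D'(1) by auto
      then show ?thesis
        using inj_on_image_set_diff[OF inj, of a D'] inj_on_image_set_diff[OF inj, of D' a] a D'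
        by (simp add: image_Un)
    qed
    ultimately show "\<exists>D\<subseteq>A. card D \<le> k \<and> c (h ` sym_diff a D) = js"
      using D D' by (intro exI[of _ D']) auto
  qed (use c(1) in auto)
qed

section \<open>Subgraphs of the cube given by available directions\<close>

definition reach :: "'a graph \<Rightarrow> nat \<Rightarrow> 'a \<Rightarrow> 'a \<Rightarrow> bool" where
  "reach G m x y \<longleftrightarrow> (\<exists>p. walk G x p y \<and> length p = Suc m)"

lemma reach_refl: "x \<in> verts G \<Longrightarrow> reach G 0 x x"
  unfolding reach_def by (intro exI[of _ "[x]"]) (simp add: walk_def)

lemma reach_edge:
  assumes "x \<in> verts G" "y \<in> verts G" "{x, y} \<in> edges G"
  shows "reach G 1 x y"
  unfolding reach_def using assms by (intro exI[of _ "[x, y]"]) (simp add: walk_def)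

lemma reach_trans:
  assumes "reach G m x y" "reach G l y z"
  shows "reach G (m + l) x z"
proof -
  obtain p q where p: "walk G x p y" "length p = Suc m" and q: "walk G y q z" "length q = Suc l"
    using assms unfolding reach_def by blast
  obtain q' where q': "q = y # q'" using q(1) by (cases q) (auto simp: walk_def)
  have "walk G x (p @ q') z"
    using p(1) q(1) unfolding q' walk_def by (cases q') (auto simp: successively_append_iff)
  then show ?thesis
    unfolding reach_def using p(2) q(2) q' by (intro exI[of _ "p @ q'"]) simp
qed

lemma reach_sym:
  assumes "reach G m x y"
  shows "reach G m y x"
proof -
  obtain p where "walk G x p y" "length p = Suc m"
    using assms unfolding reach_def by blast
  then show ?thesis
    unfolding reach_def walk_def
    by (intro exI[of _ "rev p"]) (auto simp: hd_rev last_rev successively_rev insert_commute)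
qed

lemma reach_imp_dist_le:
  assumes "reach G m x y"
  shows "graph_dist G x y \<le> enat m"
proof -
  obtain p where "walk G x p y" "length p = Suc m"
    using assms unfolding reach_def by blast
  then show ?thesis unfolding graph_dist_def by (intro INF_lower2[of p]) auto
qed

text \<open>One step of a walk changes one coordinate, so it lowers the Hamming distance to
  \<open>y\<close> by at most one.\<close>

lemma hypercube_dist_ge:
  "enat (card {i \<in> {..<n}. x i \<noteq> y i}) \<le> graph_dist (hypercube n) x y"
proof -
  have "card {i \<in> {..<n}. x i \<noteq> y i} \<le> length p - 1" if "walk (hypercube n) x p y" for p
    using that
  proof (induction p arbitrary: x)
    case Nil
    then show ?case by (simp add: walk_def)
  next
    case (Cons z p)
    then have z: "z = x" by (simp add: walk_def)
    show ?case
    proof (cases p)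
      case Nil
      then have "x = y" using Cons.prems z by (simp add: walk_def)
      then show ?thesis by simp
    next
      case (Cons w q)
      have "walk (hypercube n) w p y" "{x, w} \<in> edges (hypercube n)"
        using \<open>walk (hypercube n) x (z # p) y\<close> z Cons by (auto simp: walk_def)
      then have 1: "card {i \<in> {..<n}. w i \<noteq> y i} \<le> length p - 1"
        and "\<exists>u v. {x, w} = {u, v} \<and> card {i \<in> {..<n}. u i \<noteq> v i} = 1"
        using Cons.IH by (auto simp: hypercube_def)
      then obtain u v where uv: "{x, w} = {u, v}" "card {i \<in> {..<n}. u i \<noteq> v i} = 1" by blast
      have "x = u \<and> w = v \<or> x = v \<and> w = u" using uv(1) by (simp add: doubleton_eq_iff)
      then have "{i \<in> {..<n}. x i \<noteq> w i} = {i \<in> {..<n}. u i \<noteq> v i}" by auto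
      then have 2: "card {i \<in> {..<n}. x i \<noteq> w i} = 1"
        using uv(2) by (simp only:)
      have "{i \<in> {..<n}. x i \<noteq> y i} \<subseteq> {i \<in> {..<n}. x i \<noteq> w i} \<union> {i \<in> {..<n}. w i \<noteq> y i}" by auto
      then have "card {i \<in> {..<n}. x i \<noteq> y i} \<le> card ({i \<in> {..<n}. x i \<noteq> w i} \<union> {i \<in> {..<n}. w i \<noteq> y i})"
        by (intro card_mono) auto
      also have "\<dots> \<le> card {i \<in> {..<n}. x i \<noteq> w i} + card {i \<in> {..<n}. w i \<noteq> y i}"
        by (rule card_Un_le)
      finally show ?thesis using 1 2 Cons by simp
    qed
  qed
  then show ?thesis unfolding graph_dist_def by (auto intro!: INF_greatest)
qed

section \<open>Cube vertices as subsets of \<open>{..<n}\<close>, and the graph of available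
  directions\<close>

definition vec :: "nat \<Rightarrow> nat set \<Rightarrow> nat \<Rightarrow> bool" where
  "vec n b = (\<lambda>i\<in>{..<n}. i \<in> b)"

lemma vec_in_cube [simp]: "vec n b \<in> cube n"
  by (simp add: vec_def cube_def)

lemma cube_eq_vec:
  assumes "x \<in> cube n"
  obtains b where "b \<subseteq> {..<n}" "x = vec n b"
proof
  show "x = vec n {i \<in> {..<n}. x i}"
    using assms by (auto simp: vec_def cube_def fun_eq_iff PiE_def extensional_def)
qed auto

lemma vec_eq_iff: "b \<subseteq> {..<n} \<Longrightarrow> b' \<subseteq> {..<n} \<Longrightarrow> vec n b = vec n b' \<longleftrightarrow> b = b'"
  by (auto simp: vec_def fun_eq_iff restrict_def split: if_splits)

lemma vec_diff: "b \<subseteq> {..<n} \<Longrightarrow> b' \<subseteq> {..<n} \<Longrightarrow> {i \<in> {..<n}. vec n b i \<noteq> vec n b' i} = sym_diff b b'"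
  by (auto simp: vec_def)

definition nav_graph :: "nat \<Rightarrow> (nat set \<Rightarrow> nat set) \<Rightarrow> (nat \<Rightarrow> bool) graph" where
  "nav_graph n av = (cube n,
    {{vec n b, vec n (insert i b)} | b i. b \<subseteq> {..<n} \<and> i < n \<and> i \<notin> b \<and> i \<in> av b})"

lemma verts_nav_graph [simp]: "verts (nav_graph n av) = cube n"
  by (simp add: nav_graph_def)

lemma edges_nav_graph: "edges (nav_graph n av) \<subseteq> edges (hypercube n)"
proof
  fix e assume "e \<in> edges (nav_graph n av)"
  then obtain b i where b: "e = {vec n b, vec n (insert i b)}" "b \<subseteq> {..<n}" "i < n" "i \<notin> b"
    by (auto simp: nav_graph_def)
  have "sym_diff b (insert i b) = {i}" using b by auto
  then have "card {j \<in> {..<n}. vec n b j \<noteq> vec n (insert i b) j} = 1"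
    using vec_diff[of b n "insert i b"] b by simp
  then show "e \<in> edges (hypercube n)"
    unfolding hypercube_def snd_conv using b(1) vec_in_cube by blast
qed

text \<open>An edge at \<open>b\<close> is determined by its direction, and stability puts this
  direction into \<open>av b\<close> also when \<open>b\<close> is the upper end.\<close>

lemma max_degree_nav_graph:
  assumes "flip_stable av" "\<And>b. b \<subseteq> {..<n} \<Longrightarrow> av b \<subseteq> {..<n} \<and> real (card (av b)) \<le> d"
  shows "real (max_degree (nav_graph n av)) \<le> d"
proof -
  have deg: "real (degree (nav_graph n av) x) \<le> d" if "x \<in> cube n" for x
  proof -
    obtain b where b: "b \<subseteq> {..<n}" "x = vec n b" using cube_eq_vec[OF \<open>x \<in> cube n\<close>] by blast
    have fin: "finite (av b)" using assms(2)[OF b(1)] finite_subset by blast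
    have "{e \<in> edges (nav_graph n av). x \<in> e} \<subseteq> (\<lambda>i. {vec n b, vec n (sym_diff b {i})}) ` av b"
    proof
      fix e assume "e \<in> {e \<in> edges (nav_graph n av). x \<in> e}"
      then obtain c i where c: "e = {vec n c, vec n (insert i c)}" "c \<subseteq> {..<n}" "i < n" "i \<notin> c"
        "i \<in> av c" "x \<in> e"
        by (auto simp: nav_graph_def)
      then have "b = c \<or> b = insert i c" using b vec_eq_iff[of b n c] vec_eq_iff[of b n "insert i c"] by auto
      then show "e \<in> (\<lambda>i. {vec n b, vec n (sym_diff b {i})}) ` av b"
      proof
        assume "b = c"
        moreover have "sym_diff c {i} = insert i c" using c(4) by auto
        ultimately show ?thesis using c by (intro image_eqI[of _ _ i]) auto
      next
        assume bc: "b = insert i c"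
        then have "sym_diff b {i} = c" "c - {i} = c" using c(4) by auto
        moreover from this have "i \<in> av b" using assms(1) c(5) bc unfolding flip_stable_def by metis
        ultimately show ?thesis using c bc by (intro image_eqI[of _ _ i]) (auto simp: insert_commute)
      qed
    qed
    then have "degree (nav_graph n av) x \<le> card (av b)"
      unfolding degree_def using fin surj_card_le by blast
    then show ?thesis using assms(2)[OF b(1)] by linarith
  qed
  have fin: "finite (cube n)" unfolding cube_def by (intro finite_PiE) auto
  have ne: "cube n \<noteq> {}" using vec_in_cube by blast
  have "max_degree (nav_graph n av) \<in> degree (nav_graph n av) ` cube n"
    unfolding max_degree_def verts_nav_graph using fin ne by (intro Max_in) auto
  then show ?thesis using deg by auto
qed

lemma reach_insert:
  assumes "b \<subseteq> {..<n}" "i < n" "i \<notin> b" "i \<in> av b"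
  shows "reach (nav_graph n av) 1 (vec n b) (vec n (insert i b))"
proof -
  have "{vec n b, vec n (insert i b)} \<in> edges (nav_graph n av)"
    unfolding nav_graph_def snd_conv using assms by blast
  then show ?thesis by (intro reach_edge) simp_all
qed

lemma climb_reach:
  assumes "climb av b c" "c \<subseteq> {..<n}"
  shows "reach (nav_graph n av) (card (c - b)) (vec n b) (vec n c)"
  using assms
proof (induction rule: climb_induct)
  case (refl b)
  then show ?case by (simp add: reach_refl)
next
  case (insert i b c)
  have ic: "insert i b \<subseteq> c" using climb_subset[OF insert.hyps(3)] .
  have "c - b = insert i (c - insert i b)" using ic insert.hyps(1) by auto
  moreover have "card (insert i (c - insert i b)) = 1 + card (c - insert i b)"
    using insert.prems finite_subset[of c "{..<n}"] by simp
  ultimately have "card (c - b) = 1 + card (c - insert i b)" by (simp only:)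
  moreover have "reach (nav_graph n av) 1 (vec n b) (vec n (insert i b))"
    using ic insert by (intro reach_insert) auto
  ultimately show ?case using reach_trans insert.IH[OF insert.prems] by metis
qed

lemma reach_sym_diff:
  assumes "finite D" "D \<subseteq> {..<n}" "b \<subseteq> {..<n}" "\<And>b. D \<subseteq> av b"
  shows "reach (nav_graph n av) (card D) (vec n b) (vec n (sym_diff b D))"
  using assms
proof (induction D arbitrary: b rule: finite_induct)
  case empty
  then show ?case by (simp add: reach_refl)
next
  case (insert i D)
  have i: "i < n" "\<And>b. i \<in> av b" using insert.prems by auto
  have 1: "reach (nav_graph n av) 1 (vec n b) (vec n (sym_diff b {i}))"
  proof (cases "i \<in> b")
    case True
    then have "insert i (b - {i}) = b" "sym_diff b {i} = b - {i}" by auto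
    then show ?thesis using reach_sym[OF reach_insert[of "b - {i}" n i av]] i insert.prems(2) by auto
  next
    case False
    then have "sym_diff b {i} = insert i b" by auto
    then show ?thesis using reach_insert[of b n i av] i insert.prems(2) False by simp
  qed
  have "sym_diff (sym_diff b {i}) D = sym_diff b (insert i D)"
    using insert.hyps by auto
  then have "reach (nav_graph n av) (card D) (vec n (sym_diff b {i})) (vec n (sym_diff b (insert i D)))"
    using insert.IH[of "sym_diff b {i}"] insert.prems by auto
  then show ?case using reach_trans[OF 1] insert.hyps by simp
qed

lemma climb_lift:
  assumes "climb av' p q" "q \<subseteq> B" "a \<inter> B = {}"
    "\<And>p. p \<subseteq> B \<Longrightarrow> av' p \<subseteq> av (a \<union> p)"
  shows "climb av (a \<union> p) (a \<union> q)"
  using assms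
proof (induction rule: climb_induct)
  case (refl b)
  then show ?case by (simp add: climb_refl)
next
  case (insert i b c)
  have ic: "insert i b \<subseteq> c" using climb_subset[OF insert.hyps(3)] .
  have "climb av (insert i (a \<union> b)) (a \<union> c)" using insert.IH insert.prems by simp
  moreover have "i \<notin> a \<union> b" using ic insert by auto
  moreover have "i \<in> av (a \<union> b)" using ic insert by blast
  ultimately show ?case by (rule climb_insert[rotated 2])
qed

text \<open>The first \<open>k * 2 ^ t\<close> coordinates are control. From \<open>b\<close>, the
  path flips a control set \<open>D\<close> to reach colour \<open>js\<close>, then \<open>S\<close>
  up, \<open>S'\<close> down, and finally the control set \<open>E\<close>. As \<open>E\<close> is
  contained in \<open>D\<close> together with the control difference of \<open>b\<close> and
  \<open>b'\<close>, the excess is at most \<open>2 * card D\<close>.\<close>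

lemma spanner_of_router:
  assumes N: "k * 2 ^ t \<le> n"
    and router: "router k (Pow {..<t}) {k * 2 ^ t..<n} d av"
  shows "\<exists>G. additive_spanner (2 * k) (hypercube n) G \<and> real (max_degree G) \<le> real (k * 2 ^ t) + d"
proof -
  define A B where "A = {..<k * 2 ^ t}" and "B = {k * 2 ^ t..<n}"
  have AB: "A \<inter> B = {}" "A \<union> B = {..<n}" "finite A" "finite B" using N by (auto simp: A_def B_def)
  obtain c where c: "\<And>a. set (c a) \<subseteq> Pow {..<t} \<and> length (c a) = k"
    "\<And>a js. a \<subseteq> A \<Longrightarrow> set js \<subseteq> Pow {..<t} \<Longrightarrow> length js = k \<Longrightarrow>
      \<exists>D\<subseteq>A. card D \<le> k \<and> c (sym_diff a D) = js"
    using control_colouring[of A k t] by (auto simp: A_def)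
  define nav where "nav b = A \<union> av (c (b \<inter> A)) (b \<inter> B)" for b
  have r1: "flip_stable (av (c a))" "av (c a) b \<subseteq> B" "real (card (av (c a) b)) \<le> d" for a b
    using router c(1)[of a] unfolding router_def B_def by auto
  have r2: "\<exists>js. set js \<subseteq> Pow {..<t} \<and> length js = k \<and> routes (av js) B S \<and> routes (av js) B S'"
    if "S \<subseteq> B" "S' \<subseteq> B" for S S'
    using router that unfolding router_def B_def by blast
  let ?G = "nav_graph n nav"
  have "real (max_degree ?G) \<le> real (k * 2 ^ t) + d"
  proof (rule max_degree_nav_graph)
    show "flip_stable nav"
      unfolding flip_stable_def
    proof (intro allI)
      fix b i
      show "i \<in> nav (insert i b) \<longleftrightarrow> i \<in> nav (b - {i})"
      proof (cases "i \<in> B")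
        case True
        then have "insert i b \<inter> A = b \<inter> A" "(b - {i}) \<inter> A = b \<inter> A"
          "insert i b \<inter> B = insert i (b \<inter> B)" "(b - {i}) \<inter> B = b \<inter> B - {i}" using AB by auto
        moreover have "i \<in> av (c (b \<inter> A)) (insert i (b \<inter> B)) \<longleftrightarrow> i \<in> av (c (b \<inter> A)) (b \<inter> B - {i})"
          using r1(1) unfolding flip_stable_def by blast
        ultimately show ?thesis unfolding nav_def by simp
      next
        case False
        then show ?thesis unfolding nav_def using r1(2) by blast
      qed
    qed
    fix b :: "nat set" assume "b \<subseteq> {..<n}"
    have "card (nav b) \<le> card A + card (av (c (b \<inter> A)) (b \<inter> B))"
      unfolding nav_def by (rule card_Un_le)
    moreover have "card A = k * 2 ^ t" by (simp add: A_def)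
    ultimately have "real (card (nav b)) \<le> real (k * 2 ^ t) + d"
      using r1(3)[of "b \<inter> A" "b \<inter> B"] by linarith
    then show "nav b \<subseteq> {..<n} \<and> real (card (nav b)) \<le> real (k * 2 ^ t) + d"
      using r1(2) AB unfolding nav_def by blast
  qed
  moreover have "additive_spanner (2 * k) (hypercube n) ?G"
    unfolding additive_spanner_def
  proof (intro conjI ballI)
    show "verts ?G = verts (hypercube n)" by (simp add: hypercube_def)
    show "edges ?G \<subseteq> edges (hypercube n)" by (rule edges_nav_graph)
    fix x y assume "x \<in> verts (hypercube n)" "y \<in> verts (hypercube n)"
    then have "x \<in> cube n" "y \<in> cube n" by (auto simp: hypercube_def)
    then obtain b b' where b: "b \<subseteq> {..<n}" "x = vec n b" and b': "b' \<subseteq> {..<n}" "y = vec n b'"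
      by (metis cube_eq_vec)
    define S S' where "S = b' \<inter> B - b" and "S' = b \<inter> B - b'"
    obtain js where js: "set js \<subseteq> Pow {..<t}" "length js = k" "routes (av js) B S" "routes (av js) B S'"
      using r2[of S S'] by (auto simp: S_def S'_def)
    obtain D where D: "D \<subseteq> A" "card D \<le> k" "c (sym_diff (b \<inter> A) D) = js"
      using c(2)[of "b \<inter> A" js] js by auto
    define a where "a = sym_diff (b \<inter> A) D"
    have aA: "a \<subseteq> A" using D by (auto simp: a_def)
    have nav: "av js p \<subseteq> nav (a \<union> p)" if "p \<subseteq> B" for p
    proof -
      have "(a \<union> p) \<inter> A = a" "(a \<union> p) \<inter> B = p" using aA AB that by auto
      then show ?thesis using D(3) unfolding nav_def a_def by simp
    qed
    have fin: "finite D" "finite b" "finite b'"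
      using D b b' AB finite_subset[OF D(1)] finite_subset[of _ "{..<n}"] by auto
    \<comment> \<open>Leads from the temporary control part \<open>a\<close> to that of
      \<open>b'\<close>, undoing \<open>D\<close> and making the genuine changes together.\<close>
    define E where "E = sym_diff a (b' \<inter> A)"
    have "reach ?G (card D) (vec n b) (vec n (sym_diff b D))"
      using fin D b AB by (intro reach_sym_diff) (auto simp: nav_def)
    moreover have "sym_diff b D = a \<union> b \<inter> B" using b AB D unfolding a_def by blast
    ultimately have p1: "reach ?G (card D) (vec n b) (vec n (a \<union> b \<inter> B))" by simp
    have p2: "reach ?G (card S) (vec n (a \<union> p)) (vec n (a \<union> (p \<union> S)))"
      if "routes (av js) B S" "p \<subseteq> B" "p \<inter> S = {}" "S \<subseteq> B" for p S
    proof -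
      have "climb (av js) p (p \<union> S)" using that unfolding routes_def by blast
      then have "climb nav (a \<union> p) (a \<union> (p \<union> S))"
      proof (rule climb_lift[where B = B])
        show "p \<union> S \<subseteq> B" "a \<inter> B = {}" using that aA AB by auto
      qed (rule nav)
      moreover have "a \<union> (p \<union> S) - (a \<union> p) = S" using that aA AB by blast
      moreover have "a \<union> (p \<union> S) \<subseteq> {..<n}" using that aA AB by blast
      ultimately show ?thesis using climb_reach[of nav "a \<union> p" "a \<union> (p \<union> S)" n] by simp
    qed
    have p3: "reach ?G (card S) (vec n (a \<union> b \<inter> B)) (vec n (a \<union> (b \<inter> B \<union> S)))"
      by (rule p2[OF js(3)]) (auto simp: S_def)
    have p4: "reach ?G (card S') (vec n (a \<union> b' \<inter> B)) (vec n (a \<union> (b' \<inter> B \<union> S')))"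
      by (rule p2[OF js(4)]) (auto simp: S'_def)
    \<comment> \<open>Both climbs end at the same top, so reversing the second one performs the
      downward flips.\<close>
    have "b \<inter> B \<union> S = b' \<inter> B \<union> S'" by (auto simp: S_def S'_def)
    then have p5: "reach ?G (card S') (vec n (a \<union> (b \<inter> B \<union> S))) (vec n (a \<union> b' \<inter> B))"
      using reach_sym[OF p4] by simp
    have finE: "finite E" "E \<subseteq> A" using finite_subset aA AB by (auto simp: E_def)
    have "reach ?G (card E) (vec n (a \<union> b' \<inter> B)) (vec n (sym_diff (a \<union> b' \<inter> B) E))"
      using finE aA AB by (intro reach_sym_diff) (auto simp: nav_def)
    moreover have "sym_diff (a \<union> b' \<inter> B) E = b'" using b' AB aA unfolding E_def by blast
    ultimately have p6: "reach ?G (card E) (vec n (a \<union> b' \<inter> B)) (vec n b')" by simp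
    have "E \<subseteq> D \<union> sym_diff (b \<inter> A) (b' \<inter> A)" by (auto simp: E_def a_def)
    then have "card E \<le> card (D \<union> sym_diff (b \<inter> A) (b' \<inter> A))"
      using fin by (intro card_mono) auto
    also have "\<dots> \<le> card D + card (sym_diff (b \<inter> A) (b' \<inter> A))" by (rule card_Un_le)
    finally have cE: "card E \<le> card D + card (sym_diff (b \<inter> A) (b' \<inter> A))" .
    have eq: "sym_diff b b' = sym_diff (b \<inter> A) (b' \<inter> A) \<union> (S \<union> S')"
      using b b' AB by (auto simp: S_def S'_def)
    have "card (sym_diff (b \<inter> A) (b' \<inter> A) \<union> (S \<union> S')) =
        card (sym_diff (b \<inter> A) (b' \<inter> A)) + (card S + card S')"
      using fin AB by (subst card_Un_disjoint | force simp: S_def S'_def)+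
    then have "card (sym_diff b b') = card (sym_diff (b \<inter> A) (b' \<inter> A)) + (card S + card S')"
      unfolding eq .
    then have le: "card D + card S + card S' + card E \<le> card (sym_diff b b') + 2 * k"
      using cE D(2) by linarith
    have "reach ?G (card D + card S + card S' + card E) x y"
      using reach_trans[OF reach_trans[OF reach_trans[OF p1 p3] p5] p6] b b' by simp
    then have "graph_dist ?G x y \<le> enat (card D + card S + card S' + card E)"
      by (rule reach_imp_dist_le)
    also have "\<dots> \<le> enat (card (sym_diff b b')) + enat (2 * k)" using le by simp
    also have "\<dots> \<le> graph_dist (hypercube n) x y + enat (2 * k)"
      using hypercube_dist_ge[of n x y] vec_diff[OF b(1) b'(1)] b b' by (intro add_right_mono) simp
    finally show "graph_dist ?G x y \<le> graph_dist (hypercube n) x y + enat (2 * k)" .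
  qed
  ultimately show ?thesis by blast
qed

section \<open>Choice of parameters\<close>

lemma router_mono:
  assumes "router m I U d av" "d \<le> d'"
  shows "router m I U d' av"
proof -
  have "real (card (av js b)) \<le> d" if "set js \<subseteq> I" "length js = m" for js b
    using assms(1) that unfolding router_def by blast
  then have "real (card (av js b)) \<le> d'" if "set js \<subseteq> I" "length js = m" for js b
    using assms(2) that order_trans by blast
  then show ?thesis using assms(1) unfolding router_def by simp
qed

text \<open>Induction on the number of levels, with \<open>X\<close> as unit of degree. The bottom
  level makes all of \<open>U\<close> available, at most \<open>Suc k\<close> units; each further
  level costs at most \<open>17 * k\<close> units. Passing to \<open>W\<close> replaces
  \<open>L (Suc (Suc m))\<close> by \<open>L (Suc m)\<close> in the size bound.\<close>

lemma router_exists: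
  fixes L :: "nat \<Rightarrow> real" and I :: "'c set" and k :: nat
  defines "X \<equiv> L 0 * L (Suc k) / L 1"
  assumes L: "\<And>j. L (Suc j) = ln (L j)" "\<And>j. j \<le> Suc k \<Longrightarrow> 4 \<le> L j"
    and L2: "8 * L 2 \<le> L 1" and L1: "2 * L 1 \<le> sqrt (L 0)"
    and I: "finite I" "sqrt (L 0) \<le> real (card I)"
    and m: "m \<le> k"
    and U: "finite U" "real (card U) \<le> real (Suc k - m) * (L 0 * L (Suc k) / L (Suc m))"
  shows "\<exists>av. router m I (U :: 'a set) (real (Suc k + m * (17 * k)) * X) av"
  using m U
proof (induction m arbitrary: U)
  case 0
  then show ?case using router_mono[OF router_0[OF 0(2)]] by (auto simp: X_def)
next
  case (Suc m)
  define a b where "a = L (Suc m)" and "b = L (Suc (Suc m))"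
  have ab: "4 \<le> a" "4 \<le> b" "b = ln a"
    using L(2)[of "Suc m"] L(2)[of "Suc (Suc m)"] L(1)[of "Suc m"] Suc.prems(1) by (auto simp: a_def b_def)
  have mono: "L j \<le> L i" if "i \<le> j" "j \<le> Suc k" for i j
    using that
  proof (induction j rule: dec_induct)
    case (step j)
    then have "4 \<le> L j" using L(2)[of j] by simp
    then have "L (Suc j) \<le> L j" using ln_le_minus_one[of "L j"] L(1)[of j] by simp
    then show ?case using step by simp
  qed simp
  define n where "n = L 0"
  have n: "4 \<le> n" "4 \<le> L 1" "4 \<le> L (Suc k)"
    using L(2)[of 0] L(2)[of 1] L(2)[of "Suc k"] by (auto simp: n_def)
  have aL: "a \<le> L 1" using mono[of 1 "Suc m"] Suc.prems(1) by (simp add: a_def)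
  have bL: "8 * b \<le> L 1"
    using mono[of 2 "Suc (Suc m)"] Suc.prems(1) L2 by (simp add: b_def)
  have nn: "2 * sqrt n * L 1 \<le> n"
  proof -
    have "2 * sqrt n * L 1 = sqrt n * (2 * L 1)" by simp
    also have "\<dots> \<le> sqrt n * sqrt n" using L1 n by (intro mult_left_mono) (auto simp: n_def)
    finally show ?thesis using n by simp
  qed
  have nL: "n \<le> n * L (Suc k)" using n by simp
  have X1: "2 * sqrt n \<le> X"
  proof -
    have "2 * sqrt n * L 1 \<le> n * L (Suc k)" using nn nL by linarith
    then show ?thesis using n by (simp add: X_def n_def pos_le_divide_eq)
  qed
  have XL: "4 * L 1 \<le> X" using X1 L1 by (simp add: n_def)
  define r where "r = nat \<lceil>a / b\<rceil>"
  have r: "a / b \<le> real r" "real r \<le> a / b + 1" "r > 0"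
  proof -
    have "a / b > 0" using ab by simp
    then show "a / b \<le> real r" "real r \<le> a / b + 1" "r > 0"
      unfolding r_def by linarith+
  qed
  \<comment> \<open>The 8 makes \<open>a ^ (4 * s) = exp (4 * s * b)\<close> at most
    \<open>exp (L 1 / 2)\<close>; rounding down loses at most a factor 2, whence the 16
    below.\<close>
  define q s where "q = L 1 / (8 * b)" and "s = nat \<lfloor>q\<rfloor>"
  have "1 \<le> q" using ab bL by (simp add: q_def)
  then have "1 \<le> \<lfloor>q\<rfloor>" "real s = real_of_int \<lfloor>q\<rfloor>" by (simp_all add: s_def)
  then have q: "s > 0" "real s \<le> q" "q / 2 \<le> real s" by linarith+
  have s: "s > 0" "L 1 / (16 * b) \<le> real s" using q by (simp_all add: q_def)
  have sb: "8 * real s * b \<le> L 1"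
    using q(2) ab by (simp add: q_def pos_le_divide_eq algebra_simps)
  \<comment> \<open>Since \<open>a\<close> and \<open>b\<close> are at least 4, \<open>3 * r\<close>
    is at most \<open>a ^ 2\<close>, and \<open>a = exp b\<close> turns the power into an
    exponential.\<close>
  have "(3 * r) ^ (2 * s) \<le> card I"
  proof -
    have "a / b \<le> a / 4" using ab by (intro divide_left_mono) auto
    then have "real r \<le> a / 4 + 1" by (intro order_trans[OF r(2)] add_right_mono)
    then have "3 * real r \<le> 3 * (a / 4 + 1)" by simp
    also have "\<dots> \<le> 4 * a" using ab(1) by (simp add: field_simps)
    also have "\<dots> \<le> a ^ 2" using ab unfolding power2_eq_square by (intro mult_right_mono) auto
    finally have "(3 * real r) ^ (2 * s) \<le> (a ^ 2) ^ (2 * s)" by (intro power_mono) auto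
    also have "\<dots> = exp b ^ (4 * s)" using ab by (simp flip: power_mult)
    also have "\<dots> = exp (4 * real s * b)" by (simp flip: exp_of_nat_mult)
    also have "\<dots> \<le> exp (L 1 / 2)" using sb by simp
    also have "\<dots> = sqrt n"
    proof -
      have "exp (L 1 / 2) = sqrt (exp (L 1 / 2) ^ 2)" by simp
      also have "exp (L 1 / 2) ^ 2 = exp (L 1)" by (simp flip: exp_double)
      also have "\<dots> = n" using L(1)[of 0] n by (simp add: n_def)
      finally show ?thesis .
    qed
    also have "\<dots> \<le> real (card I)" using I by (simp add: n_def)
    finally have "real ((3 * r) ^ (2 * s)) \<le> real (card I)" by simp
    then show ?thesis unfolding of_nat_le_iff .
  qed
  moreover have "\<exists>av. router m I W (real (Suc k + m * (17 * k)) * X) av"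
    if W: "W \<subseteq> U" "real (card W) \<le> real (card U) / real r + 2 * real s" for W
  proof (rule Suc.IH)
    show "m \<le> k" using Suc.prems(1) by simp
    show "finite W" using W(1) Suc.prems(2) finite_subset by blast
    have XY: "X \<le> n * L (Suc k) / a"
      unfolding X_def n_def[symmetric] using n ab aL by (intro divide_left_mono) auto
    have "2 * real s \<le> L 1"
    proof -
      have "2 * real s \<le> 8 * real s * b"
        using mult_mono[of "2 * real s" "8 * real s" 1 b] ab(2) by simp
      also have "\<dots> \<le> L 1" by (rule sb)
      finally show ?thesis .
    qed
    \<comment> \<open>The rounding term of the covering family fits into one more unit of size, so
      the factor in the size bound grows by one per descent.\<close>
    then have "2 * real s \<le> n * L (Suc k) / a" using XL XY n by linarith
    moreover have "real (card U) / real r \<le> real (k - m) * (n * L (Suc k) / a)"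
    proof -
      have "real (card U) / real r \<le> (real (k - m) * (n * L (Suc k) / b)) / (a / b)"
        using Suc.prems(3) r(1) ab n by (intro frac_le) (auto simp: n_def b_def)
      also have "\<dots> = real (k - m) * (n * L (Suc k) / a)" using ab by simp
      finally show ?thesis .
    qed
    ultimately have "real (card W) \<le> (real (k - m) + 1) * (n * L (Suc k) / a)"
      using W(2) unfolding distrib_right by linarith
    moreover have "real (k - m) + 1 = real (Suc k - m)" using Suc.prems(1) by simp
    ultimately show "real (card W) \<le> real (Suc k - m) * (L 0 * L (Suc k) / L (Suc m))"
      by (simp only: n_def a_def)
  qed
  ultimately obtain av where av:
    "router (Suc m) I U (real (Suc k + m * (17 * k)) * X + real (card U) / real s + 1) av"
    using router_Suc[OF Suc.prems(2) s(1) r(3) I(1)] by blast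
  have X0: "1 \<le> X" using XL n by linarith
  \<comment> \<open>The factor \<open>b\<close> in \<open>s\<close> cancels the one in the size
    bound, so every level costs the same order \<open>X\<close>.\<close>
  have "real (card U) / real s \<le> (real (k - m) * (n * L (Suc k) / b)) / (L 1 / (16 * b))"
    using Suc.prems(3) s ab n by (intro frac_le) (auto simp: n_def b_def)
  also have "\<dots> = real (16 * (k - m)) * X" using ab n by (simp add: X_def n_def field_simps)
  also have "\<dots> \<le> real (16 * k) * X" using X0 by (intro mult_right_mono) auto
  finally have "real (card U) / real s \<le> real (16 * k) * X" .
  \<comment> \<open>Rounding the classes costs one more \<open>k * X\<close>, giving 17 from 16;
    here \<open>k\<close> is positive because \<open>Suc m\<close> is at most
    \<open>k\<close>.\<close>
  moreover have "1 \<le> real k * X"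
    using X0 Suc.prems(1) mult_mono[of 1 "real k" 1 X] by simp
  ultimately have "real (Suc k + m * (17 * k)) * X + real (card U) / real s + 1 \<le>
      real (Suc k + m * (17 * k)) * X + real (16 * k) * X + real k * X" by linarith
  also have "\<dots> = real (Suc k + Suc m * (17 * k)) * X" by (simp add: algebra_simps)
  finally show ?case using router_mono[OF av] by blast
qed

section \<open>Growth of the iterated logarithms and the final constants\<close>

lemma ln_eventually_small:
  fixes c :: real
  assumes "c > 0" "filterlim f at_top F"
  shows "\<forall>\<^sub>F x in F. c * ln (f x) \<le> f x"
proof -
  have "\<forall>\<^sub>F y :: real in at_top. ln y / y < 1 / c"
    using order_tendstoD(2)[OF ln_x_over_x_tendsto_0] assms(1) by simp
  then have "\<forall>\<^sub>F y :: real in at_top. c * ln y \<le> y"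
    using eventually_gt_at_top[of 0] by eventually_elim (use assms(1) in \<open>simp add: field_simps\<close>)
  then show ?thesis by (rule eventually_compose_filterlim[OF _ assms(2)])
qed

lemma iter_ln_at_top: "filterlim (iter_ln j) at_top at_top"
proof (induction j)
  case 0
  then show ?case by (simp add: iter_ln_def filterlim_ident)
next
  case (Suc j)
  have "iter_ln (Suc j) = (\<lambda>x. ln (iter_ln j x))" by (simp add: iter_ln_def fun_eq_iff)
  then show ?case using filterlim_compose[OF ln_at_top Suc] by simp
qed

lemma power_two_between:
  fixes x :: real
  assumes "1 \<le> x"
  obtains t :: nat where "x \<le> 2 ^ t" "2 ^ t \<le> 2 * x"
proof -
  obtain n where "x < 2 ^ n" using real_arch_pow[of 2 x] by auto
  define t where "t = (LEAST t. x \<le> 2 ^ t)"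
  have 1: "x \<le> 2 ^ t" unfolding t_def using \<open>x < 2 ^ n\<close> by (intro LeastI[of "\<lambda>t. x \<le> 2 ^ t" n]) simp
  show thesis
  proof (cases t)
    case 0
    then show ?thesis using that[of t] 1 assms by simp
  next
    case (Suc u)
    then have "\<not> x \<le> 2 ^ u" using not_less_Least[of u "\<lambda>t. x \<le> 2 ^ t"] by (simp add: t_def)
    then show ?thesis using that[of t] 1 Suc by simp
  qed
qed

text \<open>The left side adds \<open>k\<close> for the control coordinates to
  \<open>Suc k + 17 * k ^ 2\<close> for the router. Raising \<open>k\<close> by one multiplies it by
  at most \<open>10 ^ 4\<close>; at \<open>k = 0\<close> equality holds.\<close>

lemma constant_bound: "17 * k ^ 2 + 2 * k + 1 \<le> (10 :: nat) ^ (4 * k)"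
proof (induction k)
  case (Suc k)
  have "17 * (Suc k) ^ 2 + 2 * Suc k + 1 \<le> 10 ^ 4 * (17 * k ^ 2 + 2 * k + 1)"
    by (simp add: power2_eq_square algebra_simps)
  also have "\<dots> \<le> 10 ^ 4 * 10 ^ (4 * k)" using Suc by simp
  finally show ?case by (simp add: power_add)
qed simp

theorem theorem1p3:
  fixes k :: nat
  shows "\<forall>\<^sub>F n in sequentially.
    \<exists>G. additive_spanner (2 * k) (hypercube n) G \<and>
        real (max_degree G) \<le> 10 ^ (4 * k) * (real n * iter_ln (k + 1) (real n) / ln (real n))"
proof -
  note lims = filterlim_compose[OF iter_ln_at_top filterlim_real_sequentially]
  have sqrt: "filterlim (\<lambda>n. sqrt (real n)) at_top sequentially"
    using filterlim_compose[OF sqrt_at_top filterlim_real_sequentially] .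
  \<comment> \<open>The bound 4 is what \<open>router_exists\<close> asks for; it also makes all
    iterates in use positive.\<close>
  have "\<forall>\<^sub>F n in sequentially. \<forall>j\<in>{..Suc k}. 4 \<le> iter_ln j (real n)"
    using lims by (intro eventually_ball_finite) (auto simp: filterlim_at_top)
  moreover have "\<forall>\<^sub>F n in sequentially. 8 * ln (iter_ln 1 (real n)) \<le> iter_ln 1 (real n)"
    by (rule ln_eventually_small[OF _ lims]) simp
  moreover have "\<forall>\<^sub>F n in sequentially. 4 * ln (sqrt (real n)) \<le> sqrt (real n)"
    by (rule ln_eventually_small[OF _ sqrt]) simp
  moreover have "\<forall>\<^sub>F n in sequentially. real (2 * k) \<le> sqrt (real n)"
    using sqrt by (auto simp: filterlim_at_top)
  ultimately show ?thesis
  proof eventually_elim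
    case (elim n)
    define L where "L j = iter_ln j (real n)" for j
    define X where "X = L 0 * L (Suc k) / L 1"
    have L: "L 0 = real n" "L 1 = ln (real n)" "\<And>j. L (Suc j) = ln (L j)"
      by (simp_all add: L_def iter_ln_def)
    have L4: "4 \<le> L j" if "j \<le> Suc k" for j using elim(1) that by (simp add: L_def)
    have n: "4 \<le> real n" using L4[of 0] L(1) by simp
    have L1: "2 * L 1 \<le> sqrt (L 0)" unfolding L(1,2) using elim(3) n by (simp add: ln_sqrt)
    have L2: "8 * L 2 \<le> L 1" using elim(2) L(3)[of 1] by (simp add: L_def numeral_2_eq_2)
    \<comment> \<open>At least \<open>sqrt n\<close> symbols suffice for the router, and at most
      \<open>2 * sqrt n\<close> keep the control coordinates within \<open>k * X\<close> and within
      \<open>n\<close>.\<close>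
    obtain t :: nat where t: "sqrt n \<le> 2 ^ t" "2 ^ t \<le> 2 * sqrt n"
      using power_two_between[of "sqrt n"] n by auto
    have "2 * sqrt n * L 1 \<le> real n"
    proof -
      have "2 * sqrt n * L 1 = sqrt n * (2 * L 1)" by simp
      also have "\<dots> \<le> sqrt n * sqrt n" using L1 L(1) by (intro mult_left_mono) auto
      finally show ?thesis by simp
    qed
    also have "\<dots> \<le> real n * L (Suc k)" using L4[of "Suc k"] n by simp
    finally have X: "2 * sqrt n \<le> X"
      unfolding X_def L(1) using L4[of 1] by (simp add: pos_le_divide_eq)
    have N: "k * 2 ^ t \<le> n"
    proof -
      have "real k * 2 ^ t \<le> real k * (2 * sqrt n)" using t by (intro mult_left_mono) auto
      also have "\<dots> = real (2 * k) * sqrt n" by simp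
      also have "\<dots> \<le> sqrt n * sqrt n" using elim(4) by (intro mult_right_mono) auto
      finally have "real (k * 2 ^ t) \<le> real n" by simp
      then show ?thesis unfolding of_nat_le_iff .
    qed
    have "\<exists>av. router k (Pow {..<t}) {k * 2 ^ t..<n} (real (Suc k + k * (17 * k)) * X) av"
      unfolding X_def
    proof (rule router_exists[OF L(3) L4 L2 L1])
      show "sqrt (L 0) \<le> real (card (Pow {..<t}))" using t L(1) by (simp add: card_Pow)
      \<comment> \<open>At the top level the factor is 1 and the logarithms cancel, so the bound is
        just \<open>n\<close>.\<close>
      show "real (card {k * 2 ^ t..<n}) \<le> real (Suc k - k) * (L 0 * L (Suc k) / L (Suc k))"
        using L4[of "Suc k"] L(1) by simp
    qed auto
    then obtain G where G: "additive_spanner (2 * k) (hypercube n) G"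
      "real (max_degree G) \<le> real (k * 2 ^ t) + real (Suc k + k * (17 * k)) * X"
      using spanner_of_router[OF N] by blast
    have "real (k * 2 ^ t) \<le> real k * X" using t X by (simp add: mult_left_mono)
    then have "real (max_degree G) \<le> real k * X + real (Suc k + k * (17 * k)) * X" using G(2) by linarith
    also have "\<dots> = real (17 * k ^ 2 + 2 * k + 1) * X" by (simp add: algebra_simps power2_eq_square)
    also have "\<dots> \<le> real (10 ^ (4 * k)) * X"
    proof (rule mult_right_mono)
      show "real (17 * k ^ 2 + 2 * k + 1) \<le> real (10 ^ (4 * k))"
        using constant_bound unfolding of_nat_le_iff .
      show "0 \<le> X" using X by (rule order_trans[rotated]) simp
    qed
    finally have "real (max_degree G) \<le> 10 ^ (4 * k) * X" by simp
    then show ?case using G(1) unfolding X_def L(1,2) by (auto simp only: L_def Suc_eq_plus1)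
  qed
qed

end
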